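(* If the triangle graph $\mathcal{T}(G)$ of a graph $G$ is perfect, then $\tau_\Delta(G)\le 2\nu_\Delta(G)$.
   Context: All graphs are finite, simple and undirected. A triangle is a $K_3$ subgraph. The triangle graph $\mathcal{T}(G)$ of $G$ has one vertex for each triangle of $G$, two vertices being adjacent if and only if the corresponding triangles share an edge. A graph $H$ is perfect if $\chi(H')=\omega(H')$ for every induced subgraph $H'$ of $H$. $\nu_\Delta(G)$ is the maximum number of pairwise edge-disjoint triangles in $G$. $\tau_\Delta(G)$ is the minimum cardinality of an edge set $E'\subseteq E(G)$ such that every triangle of $G$ contains at least one edge from $E'$. *)

theory Defs
  imports "HOL-Library.Ramsey"
begin

text \<open>A graph is given by its vertex set and its edge set, an edge being a two-element
  set of vertices; \<open>[V]\<^bsup>n\<^esup>\<close> is the set of \<open>n\<close>-element subsets of \<open>V\<close>.\<close>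

definition finite_simple_graph :: "'a set \<Rightarrow> 'a set set \<Rightarrow> bool" where
  "finite_simple_graph V E \<longleftrightarrow> finite V \<and> E \<subseteq> [V]\<^bsup>2\<^esup>"

definition induced_edges :: "'a set set \<Rightarrow> 'a set \<Rightarrow> 'a set set" where
  "induced_edges E W = {e \<in> E. e \<subseteq> W}"

definition proper_coloring :: "'a set \<Rightarrow> 'a set set \<Rightarrow> nat \<Rightarrow> ('a \<Rightarrow> nat) \<Rightarrow> bool" where
  "proper_coloring V E k c \<longleftrightarrow>
     c \<in> V \<rightarrow> {..<k} \<and> (\<forall>u\<in>V. \<forall>v\<in>V. {u, v} \<in> E \<longrightarrow> c u \<noteq> c v)"

definition chromatic_number :: "'a set \<Rightarrow> 'a set set \<Rightarrow> nat" where
  "chromatic_number V E = (LEAST k. \<exists>c. proper_coloring V E k c)"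

definition clique_number :: "'a set \<Rightarrow> 'a set set \<Rightarrow> nat" where
  "clique_number V E = Max {card K | K. K \<subseteq> V \<and> clique K E}"

definition perfect_graph :: "'a set \<Rightarrow> 'a set set \<Rightarrow> bool" where
  "perfect_graph V E \<longleftrightarrow>
     (\<forall>W. W \<subseteq> V \<longrightarrow>
        chromatic_number W (induced_edges E W) = clique_number W (induced_edges E W))"

text \<open>A triangle is determined by its vertex set \<open>T\<close>; its edges are the elements of
  \<open>[T]\<^bsup>2\<^esup>\<close>.\<close>

definition triangles :: "'a set \<Rightarrow> 'a set set \<Rightarrow> 'a set set" where
  "triangles V E = {T \<in> [V]\<^bsup>3\<^esup>. clique T E}"

text \<open>The triangle graph has vertex set \<open>triangles V E\<close> and the following edge set.\<close>

definition triangle_graph_edges :: "'a set \<Rightarrow> 'a set set \<Rightarrow> 'a set set set" where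
  "triangle_graph_edges V E =
     {{S, T} | S T. S \<in> triangles V E \<and> T \<in> triangles V E \<and> S \<noteq> T \<and>
                    [S]\<^bsup>2\<^esup> \<inter> [T]\<^bsup>2\<^esup> \<noteq> {}}"

lemma finite_simple_triangle_graph:
  assumes "finite_simple_graph V E"
  shows "finite_simple_graph (triangles V E) (triangle_graph_edges V E)"
  using assms
  by (auto simp: finite_simple_graph_def triangle_graph_edges_def triangles_def
      finite_imp_finite_nsets)

definition triangle_packing_number :: "'a set \<Rightarrow> 'a set set \<Rightarrow> nat" where
  "triangle_packing_number V E =
     Max {card P | P. P \<subseteq> triangles V E \<and> pairwise (\<lambda>S T. disjnt ([S]\<^bsup>2\<^esup>) ([T]\<^bsup>2\<^esup>)) P}"

definition triangle_transversal_number :: "'a set \<Rightarrow> 'a set set \<Rightarrow> nat" where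
  "triangle_transversal_number V E =
     Min {card F | F. F \<subseteq> E \<and> (\<forall>T\<in>triangles V E. [T]\<^bsup>2\<^esup> \<inter> F \<noteq> {})}"

end

theory Submission
  imports Defs
begin

text \<open>A set of pairwise adjacent vertices of the triangle graph is a family of triangles any two
  of which share an edge, and two edges of the graph suffice to meet all of them
  (\<open>two_edges_hit_pairwise_sharing_triangles\<close>). An independent set of the triangle graph is an
  edge-disjoint family of triangles. Hence, if the vertices of the triangle graph can be
  covered by as many cliques as its largest independent set has elements, the union of the
  corresponding pairs of edges is a transversal of the required size. Such a clique cover is what
  Lovasz's theorem, that the complement of a perfect graph is perfect, provides.

  The proof of the clique cover (\<open>perfect_clique_cover\<close>) follows Lovasz: by
  \<open>clique_meets_max_indep_sets\<close> there is a clique that meets all independent sets of maximum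
  size, and removing it lowers that size by one. The existence of this clique comes from counting
  in the graph obtained by replacing vertices with cliques. Instead of constructing that graph,
  \<open>perfect_weighted_colouring\<close> gives each vertex a weight and asks for independent sets that
  contain each vertex at least as often as its weight says.\<close>

section \<open>Colourings of perfect graphs with multiplicities\<close>

lemma perfect_graph_colouring:
  assumes G: "finite_simple_graph V E" and "perfect_graph V E" and W: "W \<subseteq> V"
    and q: "\<And>K. K \<subseteq> W \<Longrightarrow> clique K E \<Longrightarrow> card K \<le> q"
  obtains c where "proper_coloring W (induced_edges E W) q c"
proof -
  let ?E = "induced_edges E W"
  have fin: "finite W"
    using G W finite_subset by (auto simp: finite_simple_graph_def)
  have no_loop: "{u} \<notin> E" for u
    using G by (auto simp: finite_simple_graph_def nsets_def)
  obtain f n where f: "bij_betw f W {..<n::nat}"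
    by (metis atLeast0LessThan ex_bij_betw_finite_nat fin)
  have "proper_coloring W ?E n f"
    unfolding proper_coloring_def
  proof (intro conjI ballI impI)
    show "f \<in> W \<rightarrow> {..<n}"
      using f by (auto simp: bij_betw_def)
    fix u v assume "u \<in> W" "v \<in> W" "{u, v} \<in> ?E"
    then show "f u \<noteq> f v"
      using f no_loop by (auto simp: bij_betw_def inj_on_def induced_edges_def)
  qed
  then have "\<exists>c. proper_coloring W ?E (chromatic_number W ?E) c"
    unfolding chromatic_number_def
    by (intro LeastI[of "\<lambda>k. \<exists>c. proper_coloring W ?E k c"] exI)
  then obtain c where c: "proper_coloring W ?E (chromatic_number W ?E) c" ..
  have "{card K | K. K \<subseteq> W \<and> clique K ?E} \<subseteq> card ` Pow W"
    by auto
  then have "finite {card K | K. K \<subseteq> W \<and> clique K ?E}"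
    using fin finite_subset by blast
  moreover have "clique {} ?E"
    by (simp add: clique_def)
  ultimately have "clique_number W ?E \<le> q"
    unfolding clique_number_def using q
    by (subst Max_le_iff) (auto simp: clique_def induced_edges_def)
  with assms have "chromatic_number W ?E \<le> q"
    by (simp add: perfect_graph_def)
  with c have "proper_coloring W ?E q c"
    by (auto simp: proper_coloring_def Pi_def)
  then show thesis
    by (rule that)
qed

lemma card_clique_Int_indep_le_1:
  assumes "clique K E" "indep S E"
  shows "card (K \<inter> S) \<le> 1"
proof -
  have "x = y" if "x \<in> K \<inter> S" "y \<in> K \<inter> S" for x y
    using assms that by (auto simp: clique_def indep_def)
  then have "\<forall>x\<in>K \<inter> S. \<forall>y\<in>K \<inter> S. x = y"
    by blast
  then show ?thesis
    by (cases "finite (K \<inter> S)") (metis One_nat_def card_le_Suc0_iff_eq, simp)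
qed

lemma sum_multiplicity:
  assumes "finite K" "finite I"
  shows "(\<Sum>v\<in>K. \<Sum>i\<in>I. of_bool (v \<in> S i)) = (\<Sum>i\<in>I. card (K \<inter> S i))"
  using assms by (subst sum.swap) (rule sum.cong, rule refl, simp)

text \<open>This is the replication lemma in weighted form: the weight of a vertex is the size of the
  clique that replaces it. Weights at most 1 amount to an induced subgraph, which perfection
  colours. If some vertex \<open>x\<close> has weight at least 2, lower its weight by one and colour by
  induction; since \<open>x\<close> still has positive weight, some colour class \<open>S\<close> contains it. Every clique
  whose original weight is \<open>q\<close> contains a vertex of \<open>S\<close> of positive weight: either \<open>x\<close> itself, or,
  if it avoids \<open>x\<close>, some other one, since its weight has not changed and it needs all \<open>q\<close>
  classes. So \<open>S\<close> may serve as one class and the remaining weights need only \<open>q - 1\<close> others.\<close>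

lemma perfect_weighted_colouring:
  fixes w :: "'a \<Rightarrow> nat"
  assumes G: "finite_simple_graph V E" and perfect: "perfect_graph V E"
    and "\<And>K. K \<subseteq> V \<Longrightarrow> clique K E \<Longrightarrow> sum w K \<le> q"
  shows "\<exists>S. (\<forall>i<q. S i \<subseteq> V \<and> indep (S i) E) \<and>
             (\<forall>v\<in>V. w v \<le> (\<Sum>i<q. of_bool (v \<in> S i)))"
  using assms(3)
proof (induction "sum w V" arbitrary: w q rule: less_induct)
  case less
  have finV: "finite V"
    using G by (simp add: finite_simple_graph_def)
  show ?case
  proof (cases "\<forall>x\<in>V. w x \<le> 1")
    case small: True
    let ?W = "{x\<in>V. w x = 1}"
    have "card K \<le> q" if K: "K \<subseteq> ?W" "clique K E" for K
    proof -
      have "sum w K = (\<Sum>x\<in>K. 1)"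
        using K by (intro sum.cong) auto
      with less.prems[of K] K show ?thesis
        by auto
    qed
    then obtain c where c: "proper_coloring ?W (induced_edges E ?W) q c"
      using perfect_graph_colouring[OF G perfect, of ?W q] by auto
    let ?S = "\<lambda>i. {x\<in>?W. c x = i}"
    have "indep (?S i) E" for i
      unfolding indep_def
    proof (intro ballI impI notI)
      fix u v assume uv: "u \<in> ?S i" "v \<in> ?S i" and "{u, v} \<in> E"
      then have "{u, v} \<in> induced_edges E ?W"
        by (simp add: induced_edges_def)
      with c uv have "c u \<noteq> c v"
        unfolding proper_coloring_def by blast
      with uv show False
        by simp
    qed
    moreover have "w v \<le> (\<Sum>i<q. of_bool (v \<in> ?S i))" if "v \<in> V" for v
    proof (cases "w v = 1")
      case True
      then have "c v < q"
        using c that by (auto simp: proper_coloring_def)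
      then have "of_bool (v \<in> ?S (c v)) \<le> (\<Sum>i<q. of_bool (v \<in> ?S i) :: nat)"
        by (intro member_le_sum) auto
      with True that show ?thesis
        by (simp del: sum_of_bool_eq)
    next
      case False
      with small that have "w v = 0"
        by (force simp: le_Suc_eq)
      then show ?thesis
        by simp
    qed
    ultimately show ?thesis
      by (intro exI[of _ ?S]) auto
  next
    case False
    then obtain x where x: "x \<in> V" "w x \<ge> 2"
      by force
    define w' where "w' = w(x := w x - 1)"
    have w'_le: "w' v \<le> w v" for v
      by (simp add: w'_def)
    have "sum w' V < sum w V"
      using x finV w'_le by (intro sum_strict_mono_ex1) (auto simp: w'_def intro!: bexI[of _ x])
    moreover have "sum w' K \<le> q" if "K \<subseteq> V" "clique K E" for K
      using less.prems[OF that] sum_mono[of K w' w] w'_le by (meson le_trans)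
    ultimately obtain S where S: "\<And>i. i < q \<Longrightarrow> S i \<subseteq> V \<and> indep (S i) E"
      and cover: "\<And>v. v \<in> V \<Longrightarrow> w' v \<le> (\<Sum>i<q. of_bool (v \<in> S i))"
      using less.hyps[of w' q] by blast
    have "(\<Sum>i<q. of_bool (x \<in> S i)) \<noteq> (0::nat)"
      using cover[of x] x by (auto simp: w'_def)
    then obtain j where j: "j < q" "x \<in> S j"
      by (auto simp del: sum_of_bool_eq)
    define w'' where "w'' v = w v - of_bool (v \<in> S j)" for v
    have w''_le: "w'' v \<le> w v" for v
      by (simp add: w''_def)
    have "sum w'' V < sum w V"
      using x j finV w''_le by (intro sum_strict_mono_ex1) (auto simp: w''_def intro!: bexI[of _ x])
    moreover have "sum w'' K \<le> q - 1" if K: "K \<subseteq> V" "clique K E" for K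
    proof (cases "\<exists>v\<in>K \<inter> S j. w v > 0")
      case True
      then obtain v where "v \<in> K" "v \<in> S j" "w v > 0"
        by auto
      then have "sum w'' K < sum w K"
        using K finV finite_subset w''_le
        by (intro sum_strict_mono_ex1) (auto simp: w''_def intro!: bexI[of _ v])
      then show ?thesis
        using less.prems[OF K] by linarith
    next
      case False
      \<comment> \<open>Vertices of weight 0 may lie in both \<open>K\<close> and \<open>S j\<close>; without them \<open>K\<close> misses \<open>S j\<close>.\<close>
      define L where "L = {v\<in>K. w v > 0}"
      have L: "finite L" "L \<subseteq> V" "clique L E" "L \<inter> S j = {}"
        using K False finV finite_subset[of K V] by (auto simp: L_def clique_def)
      have "x \<notin> K"
        using False x j by auto
      have "sum w'' K = sum w'' L"
        using K finV finite_subset[of K V]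
        by (intro sum.mono_neutral_right) (auto simp: L_def w''_def)
      also have "\<dots> \<le> sum w' L"
        using \<open>x \<notin> K\<close> by (intro sum_mono) (auto simp: L_def w''_def w'_def)
      also have "\<dots> \<le> (\<Sum>v\<in>L. \<Sum>i<q. of_bool (v \<in> S i))"
        using cover L by (intro sum_mono) blast
      also have "\<dots> = (\<Sum>i<q. card (L \<inter> S i))"
        using L by (intro sum_multiplicity) auto
      also have "\<dots> = (\<Sum>i\<in>{..<q} - {j}. card (L \<inter> S i))"
        using L j by (intro sum.mono_neutral_right) auto
      also have "\<dots> \<le> (\<Sum>i\<in>{..<q} - {j}. 1)"
        using L S by (intro sum_mono card_clique_Int_indep_le_1) auto
      finally show ?thesis
        using j by simp
    qed
    ultimately obtain T where T: "\<And>i. i < q - 1 \<Longrightarrow> T i \<subseteq> V \<and> indep (T i) E"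
      and cover'': "\<And>v. v \<in> V \<Longrightarrow> w'' v \<le> (\<Sum>i<q - 1. of_bool (v \<in> T i))"
      using less.hyps[of w'' "q - 1"] by blast
    obtain p where p: "q = Suc p"
      using j by (cases q) auto
    let ?T = "T(p := S j)"
    have "w v \<le> (\<Sum>i<q. of_bool (v \<in> ?T i))" if "v \<in> V" for v
    proof -
      have "w v \<le> w'' v + of_bool (v \<in> S j)"
        by (simp add: w''_def)
      also have "\<dots> \<le> (\<Sum>i<p. of_bool (v \<in> T i)) + of_bool (v \<in> S j)"
        using cover''[OF that] p by simp
      also have "(\<Sum>i<p. of_bool (v \<in> T i)) = (\<Sum>i<p. of_bool (v \<in> ?T i) :: nat)"
        by (intro sum.cong) auto
      finally show ?thesis
        by (simp add: p del: sum_of_bool_eq)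
    qed
    moreover have "?T i \<subseteq> V \<and> indep (?T i) E" if "i < q" for i
      using that T S[OF j(1)] p by auto
    ultimately show ?thesis
      by blast
  qed
qed

section \<open>Clique covers of perfect graphs\<close>

text \<open>If there is no such clique, choose for every clique \<open>K\<close> in \<open>W\<close> an independent set \<open>A K\<close> of
  size \<open>a\<close> in \<open>W\<close> disjoint from it, and let the weight of a vertex be the number of sets \<open>A K\<close>
  that contain it. With \<open>n\<close> the number
  of cliques, the total weight is \<open>n * a\<close>; a clique has weight less than \<open>n\<close>, because it meets
  each \<open>A K\<close> at most once and misses its own. Then \<open>n - 1\<close> independent sets of size at most \<open>a\<close>
  would carry a total weight of \<open>n * a\<close>.\<close>

lemma clique_meets_max_indep_sets:
  assumes G: "finite_simple_graph V E" and perfect: "perfect_graph V E"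
    and W: "W \<subseteq> V" and "a > 0"
    and max: "\<And>S. S \<subseteq> W \<Longrightarrow> indep S E \<Longrightarrow> card S \<le> a"
  obtains K where "K \<subseteq> W" "clique K E"
    "\<And>S. S \<subseteq> W \<Longrightarrow> indep S E \<Longrightarrow> card S = a \<Longrightarrow> S \<inter> K \<noteq> {}"
proof (rule ccontr)
  assume "\<not> thesis"
  with that have "\<forall>K. K \<subseteq> W \<and> clique K E \<longrightarrow>
      (\<exists>S. S \<subseteq> W \<and> indep S E \<and> card S = a \<and> S \<inter> K = {})"
    by metis
  then obtain A where A: "\<And>K. K \<subseteq> W \<Longrightarrow> clique K E \<Longrightarrow>
      A K \<subseteq> W \<and> indep (A K) E \<and> card (A K) = a \<and> A K \<inter> K = {}"
    by metis
  have fin: "finite V" "finite W"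
    using G W finite_subset by (auto simp: finite_simple_graph_def)
  define \<K> where "\<K> = {K. K \<subseteq> W \<and> clique K E}"
  have \<K>: "finite \<K>" "{} \<in> \<K>"
    using fin by (auto simp: \<K>_def clique_def)
  define w where "w v = (\<Sum>K\<in>\<K>. of_bool (v \<in> A K) :: nat)" for v
  have "sum w X \<le> card \<K> - 1" if X: "X \<subseteq> V" "clique X E" for X
  proof -
    \<comment> \<open>Weights vanish outside \<open>W\<close>, so the clique may be cut down to \<open>W\<close>.\<close>
    define Y where "Y = X \<inter> W"
    have Y: "Y \<in> \<K>" "clique Y E"
      using X by (auto simp: Y_def \<K>_def clique_def)
    have finX: "finite X"
      using X fin finite_subset by blast
    have "sum w X = (\<Sum>K\<in>\<K>. card (X \<inter> A K))"
      unfolding w_def using finX \<K> by (intro sum_multiplicity) auto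
    also have "\<dots> = (\<Sum>K\<in>\<K>. card (Y \<inter> A K))"
      using A by (intro sum.cong refl arg_cong[where f = card]) (auto simp: Y_def \<K>_def)
    also have "\<dots> = (\<Sum>K\<in>\<K> - {Y}. card (Y \<inter> A K))"
    proof (intro sum.mono_neutral_right)
      have "A Y \<inter> Y = {}"
        using A Y by (auto simp: \<K>_def)
      then show "\<forall>K\<in>\<K> - (\<K> - {Y}). card (Y \<inter> A K) = 0"
        by (auto simp: Int_commute)
    qed (use \<K> in auto)
    also have "\<dots> \<le> (\<Sum>K\<in>\<K> - {Y}. 1)"
      using Y A by (intro sum_mono card_clique_Int_indep_le_1) (auto simp: \<K>_def)
    also have "\<dots> = card \<K> - 1"
      using Y \<K> by simp
    finally show ?thesis .
  qed
  then obtain S where S: "\<And>i. i < card \<K> - 1 \<Longrightarrow> S i \<subseteq> V \<and> indep (S i) E"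
    and cover: "\<And>v. v \<in> V \<Longrightarrow> w v \<le> (\<Sum>i<card \<K> - 1. of_bool (v \<in> S i))"
    using perfect_weighted_colouring[OF G perfect, of w "card \<K> - 1"] by blast
  have "card \<K> * a = (\<Sum>K\<in>\<K>. card (W \<inter> A K))"
    using A by (simp add: \<K>_def Int_absorb1)
  also have "\<dots> = sum w W"
    unfolding w_def using fin \<K> by (intro sum_multiplicity[symmetric]) auto
  also have "\<dots> \<le> (\<Sum>v\<in>W. \<Sum>i<card \<K> - 1. of_bool (v \<in> S i))"
    using cover W by (intro sum_mono) blast
  also have "\<dots> = (\<Sum>i<card \<K> - 1. card (W \<inter> S i))"
    using fin by (intro sum_multiplicity) auto
  also have "\<dots> \<le> (\<Sum>i<card \<K> - 1. a)"
    using S by (intro sum_mono max) (auto simp: indep_def)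
  finally have "card \<K> * a \<le> (card \<K> - 1) * a"
    by simp
  moreover have "card \<K> > 0"
    using \<K> card_gt_0_iff by blast
  ultimately show False
    using \<open>a > 0\<close> by simp
qed

text \<open>In terms of the complement this bounds the chromatic number of an induced subgraph by its
  clique number, as Lovasz's theorem requires. Stating it for all subsets \<open>W\<close> lets the induction
  remove the cliques one after the other.\<close>

lemma perfect_clique_cover:
  assumes G: "finite_simple_graph V E" and perfect: "perfect_graph V E"
    and "W \<subseteq> V" and "\<And>S. S \<subseteq> W \<Longrightarrow> indep S E \<Longrightarrow> card S \<le> a"
  shows "\<exists>C. (\<forall>i<a. clique (C i) E) \<and> W = (\<Union>i<a. C i)"
  using assms(3,4)
proof (induction a arbitrary: W)
  case 0
  have "v \<notin> W" for v
    using 0(2)[of "{v}"] by (auto simp: indep_def)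
  then have "W = {}"
    by blast
  then show ?case
    by simp
next
  case (Suc a)
  obtain K where K: "K \<subseteq> W" "clique K E"
    and meets: "\<And>S. S \<subseteq> W \<Longrightarrow> indep S E \<Longrightarrow> card S = Suc a \<Longrightarrow> S \<inter> K \<noteq> {}"
    using clique_meets_max_indep_sets[OF G perfect Suc.prems(1) zero_less_Suc Suc.prems(2)] by blast
  have "card S \<le> a" if "S \<subseteq> W - K" "indep S E" for S
  proof -
    have "S \<subseteq> W" "S \<inter> K = {}"
      using that by auto
    with Suc.prems(2)[of S] meets[of S] that(2) show ?thesis
      by (auto simp: le_Suc_eq)
  qed
  then obtain C where C: "\<forall>i<a. clique (C i) E" "W - K = (\<Union>i<a. C i)"
    using Suc.IH[of "W - K"] Suc.prems(1) by blast
  have "W = (\<Union>i<Suc a. (C(a := K)) i)"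
    using C(2) K by (auto simp: lessThan_Suc)
  with C(1) K show ?case
    by (intro exI[of _ "C(a := K)"]) (auto simp: less_Suc_eq)
qed

section \<open>Triangles that pairwise share an edge\<close>

lemma nsets_2_Int_nonempty_iff:
  "[S]\<^bsup>2\<^esup> \<inter> [T]\<^bsup>2\<^esup> \<noteq> {} \<longleftrightarrow> (\<exists>a b. a \<noteq> b \<and> {a, b} \<subseteq> S \<inter> T)"
proof -
  have "[S]\<^bsup>2\<^esup> \<inter> [T]\<^bsup>2\<^esup> = [S \<inter> T]\<^bsup>2\<^esup>"
    by (auto simp: nsets_def)
  then show ?thesis
    by (simp add: nsets_2_eq) blast
qed

text \<open>Two distinct triangles \<open>{a, b, c}\<close> and \<open>{a, b, d}\<close> of the family determine the two edges
  \<open>{a, b}\<close> and \<open>{c, d}\<close>: a triangle that does not contain both \<open>a\<close> and \<open>b\<close> can share an edge with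
  each of the two only if it contains \<open>c\<close> and \<open>d\<close>.\<close>

lemma two_edges_hit_pairwise_sharing_triangles:
  assumes C: "C \<subseteq> triangles V E" and cl: "clique C (triangle_graph_edges V E)"
  obtains F where "F \<subseteq> E" "card F \<le> 2" "finite F" "\<And>T. T \<in> C \<Longrightarrow> [T]\<^bsup>2\<^esup> \<inter> F \<noteq> {}"
proof (cases "\<exists>S\<in>C. \<exists>T\<in>C. S \<noteq> T")
  case True
  then obtain S T where ST: "S \<in> C" "T \<in> C" "S \<noteq> T"
    by blast
  have share: "\<exists>a b. a \<noteq> b \<and> {a, b} \<subseteq> X \<inter> Y" if "X \<in> C" "Y \<in> C" "X \<noteq> Y" for X Y
  proof -
    have "{X, Y} \<in> triangle_graph_edges V E"
      using cl that by (auto simp: clique_def)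
    then have "[X]\<^bsup>2\<^esup> \<inter> [Y]\<^bsup>2\<^esup> \<noteq> {}"
      by (auto simp: triangle_graph_edges_def doubleton_eq_iff)
    then show ?thesis
      by (simp only: nsets_2_Int_nonempty_iff)
  qed
  have card3: "card X = 3" if "X \<in> C" for X
    using C that by (auto simp: triangles_def nsets_def)
  have third: "\<exists>c. X = {a, b, c} \<and> c \<noteq> a \<and> c \<noteq> b" if "X \<in> C" "a \<in> X" "b \<in> X" "a \<noteq> b" for X a b
    using card3[OF \<open>X \<in> C\<close>] that by (auto simp: card_3_iff)
  obtain a b where ab: "a \<noteq> b" "{a, b} \<subseteq> S \<inter> T"
    using share ST by blast
  obtain c where c: "S = {a, b, c}" "c \<noteq> a" "c \<noteq> b"
    using third[of S a b] ST ab by auto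
  obtain d where d: "T = {a, b, d}" "d \<noteq> a" "d \<noteq> b"
    using third[of T a b] ST ab by auto
  have "c \<noteq> d"
    using c d ST by auto
  have edge: "{u, v} \<in> E" if "X \<in> C" "u \<in> X" "v \<in> X" "u \<noteq> v" for X u v
    using C that by (auto simp: triangles_def clique_def)
  show thesis
  proof
    \<comment> \<open>\<open>{c, d}\<close> need not be an edge if every triangle of the family contains \<open>{a, b}\<close>.\<close>
    let ?F = "{{a, b}, {c, d}} \<inter> E"
    have "card {{a, b}, {c, d}} \<le> 2"
      by (simp add: card_insert_if)
    then show "card ?F \<le> 2"
      by (meson card_mono finite.emptyI finite_insert inf_le1 le_trans)
    fix X assume X: "X \<in> C"
    have "a \<in> X \<and> b \<in> X \<or> c \<in> X \<and> d \<in> X"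
      using share[of X S] share[of X T] X ST c d by (cases "X = S"; cases "X = T") auto
    then have "{a, b} \<in> [X]\<^bsup>2\<^esup> \<inter> ?F \<or> {c, d} \<in> [X]\<^bsup>2\<^esup> \<inter> ?F"
      using edge[OF X] ab \<open>c \<noteq> d\<close> by auto
    then show "[X]\<^bsup>2\<^esup> \<inter> ?F \<noteq> {}"
      by blast
  qed auto
next
  case False
  show thesis
  proof (cases "C = {}")
    case True
    show thesis
      by (rule that[of "{}"]) (use True in auto)
  next
    case False
    with \<open>\<not> (\<exists>S\<in>C. \<exists>T\<in>C. S \<noteq> T)\<close> obtain T where T: "C = {T}"
      by blast
    with C have "card T = 3" "clique T E"
      by (auto simp: triangles_def nsets_def)
    then obtain a b where "a \<in> T" "b \<in> T" "a \<noteq> b"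
      by (auto simp: card_3_iff)
    with \<open>clique T E\<close> show thesis
      by (intro that[of "{{a, b}}"]) (auto simp: T clique_def nsets_2_eq)
  qed
qed

section \<open>Transversals and packings of triangles\<close>

lemma triangle_transversal_number_le:
  assumes "finite_simple_graph V E" "F \<subseteq> E" "\<And>T. T \<in> triangles V E \<Longrightarrow> [T]\<^bsup>2\<^esup> \<inter> F \<noteq> {}"
  shows "triangle_transversal_number V E \<le> card F"
proof -
  have "finite E"
    using assms(1) by (auto simp: finite_simple_graph_def intro: finite_subset finite_imp_finite_nsets)
  moreover have "{card F | F. F \<subseteq> E \<and> (\<forall>T\<in>triangles V E. [T]\<^bsup>2\<^esup> \<inter> F \<noteq> {})} \<subseteq> card ` Pow E"
    by auto
  ultimately show ?thesis
    unfolding triangle_transversal_number_def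
    using assms by (intro Min_le) (auto intro: finite_subset)
qed

lemma card_indep_le_triangle_packing_number:
  assumes G: "finite_simple_graph V E" and P: "P \<subseteq> triangles V E"
    and indep: "indep P (triangle_graph_edges V E)"
  shows "card P \<le> triangle_packing_number V E"
proof -
  have "finite (triangles V E)"
    using finite_simple_triangle_graph[OF G] by (simp add: finite_simple_graph_def)
  moreover have "{card P | P. P \<subseteq> triangles V E \<and>
      pairwise (\<lambda>S T. disjnt ([S]\<^bsup>2\<^esup>) ([T]\<^bsup>2\<^esup>)) P} \<subseteq> card ` Pow (triangles V E)"
    by auto
  moreover have "pairwise (\<lambda>S T. disjnt ([S]\<^bsup>2\<^esup>) ([T]\<^bsup>2\<^esup>)) P"
    using indep P unfolding pairwise_def indep_def triangle_graph_edges_def disjnt_def by blast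
  ultimately show ?thesis
    unfolding triangle_packing_number_def
    using P by (intro Max_ge) (auto intro: finite_subset)
qed

theorem theorem18:
  fixes V :: "'a set" and E :: "'a set set"
  assumes "finite_simple_graph V E"
    and "perfect_graph (triangles V E) (triangle_graph_edges V E)"
  shows "triangle_transversal_number V E \<le> 2 * triangle_packing_number V E"
proof -
  let ?\<nu> = "triangle_packing_number V E"
  obtain C where C: "\<forall>i<?\<nu>. clique (C i) (triangle_graph_edges V E)"
    and cover: "triangles V E = (\<Union>i<?\<nu>. C i)"
    using perfect_clique_cover[OF finite_simple_triangle_graph[OF assms(1)] assms(2) subset_refl
        card_indep_le_triangle_packing_number[OF assms(1)]] by blast
  have "\<forall>i<?\<nu>. \<exists>F. F \<subseteq> E \<and> card F \<le> 2 \<and> finite F \<and> (\<forall>T\<in>C i. [T]\<^bsup>2\<^esup> \<inter> F \<noteq> {})"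
  proof (intro allI impI)
    fix i assume "i < ?\<nu>"
    with C cover have "C i \<subseteq> triangles V E" "clique (C i) (triangle_graph_edges V E)"
      by auto
    then show "\<exists>F. F \<subseteq> E \<and> card F \<le> 2 \<and> finite F \<and> (\<forall>T\<in>C i. [T]\<^bsup>2\<^esup> \<inter> F \<noteq> {})"
      using two_edges_hit_pairwise_sharing_triangles by metis
  qed
  then obtain F where F: "\<And>i. i < ?\<nu> \<Longrightarrow> F i \<subseteq> E \<and> card (F i) \<le> 2"
    and hit: "\<And>i T. i < ?\<nu> \<Longrightarrow> T \<in> C i \<Longrightarrow> [T]\<^bsup>2\<^esup> \<inter> F i \<noteq> {}"
    by metis
  have "[T]\<^bsup>2\<^esup> \<inter> (\<Union>i<?\<nu>. F i) \<noteq> {}" if "T \<in> triangles V E" for T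
    using that cover hit by blast
  then have "triangle_transversal_number V E \<le> card (\<Union>i<?\<nu>. F i)"
    using assms(1) F by (intro triangle_transversal_number_le) auto
  also have "\<dots> \<le> (\<Sum>i<?\<nu>. card (F i))"
    by (intro card_UN_le) simp
  also have "\<dots> \<le> (\<Sum>i<?\<nu>. 2)"
    using F by (intro sum_mono) auto
  finally show ?thesis
    by simp
qed

end
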